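(* Let $a<b$ be real numbers and let $f:[a,b]\to\mathbb{R}$ be convex. Then for each $N\in\mathbb{N}$ and each $0\leq \nu\leq 1$, $$f\left((1-\nu)a+\nu b\right)+\sum_{j=1}^{N}A_j(\nu)\,\Delta_jf(\nu;a,b)\leq (1-\nu)f(a)+\nu f(b).$$
   Context: $\mathbb{N}=\{1,2,3,\dots\}$ and $[\cdot]$ denotes the integer part (floor). For $0\le\nu\le 1$ and $j\in\mathbb{N}$ let $k_j(\nu)=[2^{j-1}\nu]$, $r_j(\nu)=[2^{j}\nu]$ and $$A_j(\nu)=(-1)^{r_j(\nu)}2^{j-1}\nu+(-1)^{r_j(\nu)+1}\left[\frac{r_j(\nu)+1}{2}\right].$$ For a function $f:[a,b]\to\mathbb{R}$ let $$\Delta_jf(\nu;a,b)=f\left(\left(1-\tfrac{k_j(\nu)}{2^{j-1}}\right)a+\tfrac{k_j(\nu)}{2^{j-1}}b\right)+f\left(\left(1-\tfrac{k_j(\nu)+1}{2^{j-1}}\right)a+\tfrac{k_j(\nu)+1}{2^{j-1}}b\right)-2f\left(\left(1-\tfrac{2k_j(\nu)+1}{2^{j}}\right)a+\tfrac{2k_j(\nu)+1}{2^{j}}b\right),$$ with the convention that $f(x)=0$ for $x\notin[a,b]$ (points outside $[a,b]$ occur only when $\nu=1$). *)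

theory Defs
  imports "HOL-Analysis.Analysis"
begin

text \<open>
  The index \<open>j\<close> is a positive natural number throughout, so the truncated subtraction in
  \<open>2 ^ (j - 1)\<close> is the ordinary one. The integer part is the floor.
\<close>

definition dyadic_k :: "nat \<Rightarrow> real \<Rightarrow> int" where
  "dyadic_k j \<nu> = \<lfloor>2 ^ (j - 1) * \<nu>\<rfloor>"

definition dyadic_r :: "nat \<Rightarrow> real \<Rightarrow> int" where
  "dyadic_r j \<nu> = \<lfloor>2 ^ j * \<nu>\<rfloor>"

definition dyadic_A :: "nat \<Rightarrow> real \<Rightarrow> real" where
  "dyadic_A j \<nu> =
     (- 1) powi (dyadic_r j \<nu>) * 2 ^ (j - 1) * \<nu>
     + (- 1) powi (dyadic_r j \<nu> + 1) * of_int \<lfloor>(of_int (dyadic_r j \<nu>) + 1) / 2 :: real\<rfloor>"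

text \<open>
  A function on \<open>[a, b]\<close> is a total function of which only the values on \<open>{a..b}\<close> matter.
  The following extension by zero is the convention that \<open>f x = 0\<close> for \<open>x\<close> outside \<open>[a, b]\<close>;
  it is needed because for \<open>\<nu> = 1\<close> two of the three nodes of \<open>dyadic_Delta\<close> lie to the
  right of \<open>b\<close>.
\<close>

definition zero_ext :: "real \<Rightarrow> real \<Rightarrow> (real \<Rightarrow> real) \<Rightarrow> real \<Rightarrow> real" where
  "zero_ext a b f x = (if x \<in> {a..b} then f x else 0)"

definition dyadic_Delta ::
    "nat \<Rightarrow> (real \<Rightarrow> real) \<Rightarrow> real \<Rightarrow> real \<Rightarrow> real \<Rightarrow> real" where
  "dyadic_Delta j f \<nu> a b =
     (let k = real_of_int (dyadic_k j \<nu>); F = zero_ext a b f in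
        F ((1 - k / 2 ^ (j - 1)) * a + k / 2 ^ (j - 1) * b)
      + F ((1 - (k + 1) / 2 ^ (j - 1)) * a + (k + 1) / 2 ^ (j - 1) * b)
      - 2 * F ((1 - (2 * k + 1) / 2 ^ j) * a + (2 * k + 1) / 2 ^ j * b))"

end

theory Submission
  imports Defs
begin

text \<open>
  With \<open>g t = f ((1 - t) * a + t * b)\<close>, the product of \<open>dyadic_A j \<nu>\<close> and
  \<open>dyadic_Delta j f \<nu> a b\<close> is the difference at \<open>\<nu>\<close> of the piecewise linear interpolants of
  \<open>g\<close> on the dyadic grids of mesh \<open>1 / 2 ^ (j - 1)\<close> and \<open>1 / 2 ^ j\<close>. The sum telescopes to
  the chord of \<open>g\<close> on \<open>[0, 1]\<close> minus the interpolant of level \<open>N\<close>, and the latter is at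
  least \<open>g \<nu>\<close> by convexity.
\<close>

definition dyadic_interp :: "(real \<Rightarrow> real) \<Rightarrow> nat \<Rightarrow> real \<Rightarrow> real" where
  "dyadic_interp g m \<nu> =
     (1 - frac (2 ^ m * \<nu>)) * g (of_int \<lfloor>2 ^ m * \<nu>\<rfloor> / 2 ^ m)
     + frac (2 ^ m * \<nu>) * g ((of_int \<lfloor>2 ^ m * \<nu>\<rfloor> + 1) / 2 ^ m)"

lemma floor_double:
  fixes x :: real
  shows "\<lfloor>2 * x\<rfloor> = (if frac x < 1 / 2 then 2 * \<lfloor>x\<rfloor> else 2 * \<lfloor>x\<rfloor> + 1)"
  unfolding frac_def by (auto intro!: floor_unique) linarith+

lemma frac_double:
  fixes x :: real
  shows "frac (2 * x) = (if frac x < 1 / 2 then 2 * frac x else 2 * frac x - 1)"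
  using floor_double[of x] by (simp add: frac_def)

text \<open>The parity of \<open>dyadic_r (Suc m) \<nu>\<close> tells in which half of its unit cell
  \<open>2 ^ m * \<nu>\<close> lies, so the alternating signs yield the distance from
  \<open>2 ^ m * \<nu>\<close> to the nearest integer.\<close>

lemma dyadic_A_Suc:
  "dyadic_A (Suc m) \<nu> =
     (if frac (2 ^ m * \<nu>) < 1 / 2 then frac (2 ^ m * \<nu>) else 1 - frac (2 ^ m * \<nu>))"
proof -
  define x where "x = 2 ^ m * \<nu>"
  have r: "dyadic_r (Suc m) \<nu> = \<lfloor>2 * x\<rfloor>"
    by (simp add: dyadic_r_def x_def mult.assoc)
  have A: "dyadic_A (Suc m) \<nu> = (- 1) powi \<lfloor>2 * x\<rfloor> * x
      + (- 1) powi (\<lfloor>2 * x\<rfloor> + 1) * of_int \<lfloor>(of_int \<lfloor>2 * x\<rfloor> + 1) / 2 :: real\<rfloor>"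
    unfolding dyadic_A_def r by (simp add: x_def mult.assoc)
  have "dyadic_A (Suc m) \<nu> = (if frac x < 1 / 2 then frac x else 1 - frac x)"
  proof (cases "frac x < 1 / 2")
    case True
    then have fl: "\<lfloor>2 * x\<rfloor> = 2 * \<lfloor>x\<rfloor>"
      by (simp add: floor_double)
    have h: "\<lfloor>(of_int (2 * \<lfloor>x\<rfloor>) + 1) / 2 :: real\<rfloor> = \<lfloor>x\<rfloor>"
      by (rule floor_unique) auto
    show ?thesis
      unfolding A fl h using True by (simp add: frac_def power_int_minus_left)
  next
    case False
    then have fl: "\<lfloor>2 * x\<rfloor> = 2 * \<lfloor>x\<rfloor> + 1"
      by (simp add: floor_double)
    have h: "\<lfloor>(of_int (2 * \<lfloor>x\<rfloor> + 1) + 1) / 2 :: real\<rfloor> = \<lfloor>x\<rfloor> + 1"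
      by (rule floor_unique) auto
    show ?thesis
      unfolding A fl h using False by (simp add: frac_def power_int_minus_left)
  qed
  then show ?thesis by (simp add: x_def)
qed

text \<open>Refining the grid only adds the midpoint of the cell. The two interpolants agree at the
  ends of the cell and differ by half of \<open>dyadic_Delta\<close> at its midpoint, where the hat
  function \<open>dyadic_A\<close> equals 1/2. The identity is purely algebraic, with no restriction
  on \<open>\<nu>\<close>.\<close>

lemma dyadic_A_Delta_Suc:
  defines "G \<equiv> \<lambda>a b f t. zero_ext a b f ((1 - t) * a + t * b)"
  shows "dyadic_A (Suc m) \<nu> * dyadic_Delta (Suc m) f \<nu> a b =
    dyadic_interp (G a b f) m \<nu> - dyadic_interp (G a b f) (Suc m) \<nu>"
proof -
  define x where "x = 2 ^ m * \<nu>"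
  define g where "g = G a b f"
  have x2: "2 ^ Suc m * \<nu> = 2 * x"
    by (simp add: x_def)
  have D: "dyadic_Delta (Suc m) f \<nu> a b =
      g (\<lfloor>x\<rfloor> / 2 ^ m) + g ((\<lfloor>x\<rfloor> + 1) / 2 ^ m) - 2 * g ((2 * \<lfloor>x\<rfloor> + 1) / 2 ^ Suc m)"
    by (simp add: dyadic_Delta_def Let_def g_def G_def dyadic_k_def x_def)
  have cancel: "(2 * y) / 2 ^ Suc m = y / 2 ^ m" for y :: real
    by simp
  have "dyadic_interp g m \<nu> - dyadic_interp g (Suc m) \<nu> =
      dyadic_A (Suc m) \<nu> * dyadic_Delta (Suc m) f \<nu> a b"
  proof (cases "frac x < 1 / 2")
    case True
    then show ?thesis
      unfolding dyadic_interp_def x2 D dyadic_A_Suc x_def[symmetric]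
      by (simp add: floor_double frac_double) (simp add: algebra_simps)
  next
    case False
    \<comment> \<open>In the right half, the fine cell and the coarse cell share their right
      endpoint.\<close>
    have "(2 * real_of_int \<lfloor>x\<rfloor> + 1 + 1) / 2 ^ Suc m = (\<lfloor>x\<rfloor> + 1) / 2 ^ m"
      using cancel[of "\<lfloor>x\<rfloor> + 1"] by (simp add: algebra_simps)
    with False show ?thesis
      unfolding dyadic_interp_def x2 D dyadic_A_Suc x_def[symmetric]
      by (simp add: floor_double frac_double del: power_Suc) (simp add: algebra_simps)
  qed
  then show ?thesis by (simp add: g_def)
qed

lemma convex_on_le_dyadic_interp:
  assumes "convex_on {0..1} g" and "0 \<le> \<nu>" and "\<nu> \<le> 1"
  shows "g \<nu> \<le> dyadic_interp g m \<nu>"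
proof (cases "\<nu> = 1")
  \<comment> \<open>Here the right node \<open>1 + 1 / 2 ^ m\<close> leaves \<open>{0..1}\<close>,
    but its weight is 0 and equality holds.\<close>
  case True
  have "\<lfloor>2 ^ m :: real\<rfloor> = 2 ^ m"
    by (metis floor_of_int of_int_numeral of_int_power)
  then show ?thesis
    by (simp add: dyadic_interp_def True frac_def)
next
  case False
  define x where "x = 2 ^ m * \<nu>"
  define k where "k = \<lfloor>x\<rfloor>"
  have k0: "0 \<le> k"
    using assms(2) by (simp add: k_def x_def)
  have "x < 2 ^ m"
    using False assms(3) by (simp add: x_def)
  then have "k < 2 ^ m"
    by (simp add: k_def floor_less_iff)
  \<comment> \<open>Strict inequality between integers gains the 1 that keeps the right node of the
    cell at most 1.\<close>
  then have "real_of_int (k + 1) \<le> of_int (2 ^ m)"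
    by (subst of_int_le_iff) simp
  then have k1: "real_of_int k + 1 \<le> 2 ^ m"
    by simp
  have "\<nu> = (1 - frac x) * (of_int k / 2 ^ m) + frac x * ((of_int k + 1) / 2 ^ m)"
    by (simp add: frac_def x_def k_def field_simps)
  also have "g \<dots> \<le> (1 - frac x) * g (of_int k / 2 ^ m) + frac x * g ((of_int k + 1) / 2 ^ m)"
    using convex_onD[OF assms(1), of "frac x" "of_int k / 2 ^ m" "(of_int k + 1) / 2 ^ m"]
      k0 k1 \<open>k < 2 ^ m\<close> frac_lt_1[of x] by simp
  finally show ?thesis
    by (simp add: dyadic_interp_def x_def k_def)
qed

theorem theorem2p5:
  fixes a b \<nu> :: real and f :: "real \<Rightarrow> real" and N :: nat
  assumes "a < b"
    and "convex_on {a..b} f"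
    and "1 \<le> N"
    and "0 \<le> \<nu>" and "\<nu> \<le> 1"
  shows "f ((1 - \<nu>) * a + \<nu> * b) + (\<Sum>j = 1..N. dyadic_A j \<nu> * dyadic_Delta j f \<nu> a b)
           \<le> (1 - \<nu>) * f a + \<nu> * f b"
proof -
  \<comment> \<open>Extending by zero makes \<open>g\<close> the function of the telescoping
    identity, including at the nodes beyond 1; on \<open>{0..1}\<close> it reduces to
    \<open>f\<close>.\<close>
  define g where "g t = zero_ext a b f ((1 - t) * a + t * b)" for t
  have mem: "(1 - t) * a + t * b \<in> {a..b}" if "t \<in> {0..1}" for t
    using convexD_alt[of "{a..b}" a b t] that assms(1) by simp
  have g: "g t = f ((1 - t) * a + t * b)" if "t \<in> {0..1}" for t
    using mem[OF that] by (simp add: g_def zero_ext_def)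
  have "convex_on {0..1} g"
  proof (rule convex_onI)
    fix t x y :: real
    assume t: "0 < t" "t < 1" and xy: "x \<in> {0..1}" "y \<in> {0..1}"
    have c: "(1 - t) * x + t * y \<in> {0..1}"
      using convexD_alt[of "{0..1::real}" x y t] t xy by simp
    \<comment> \<open>Convexity passes to \<open>g\<close> because the parametrization of
      \<open>{a..b}\<close> is affine.\<close>
    have "(1 - ((1 - t) * x + t * y)) * a + ((1 - t) * x + t * y) * b =
        (1 - t) * ((1 - x) * a + x * b) + t * ((1 - y) * a + y * b)"
      by (simp add: algebra_simps)
    then show "g ((1 - t) *\<^sub>R x + t *\<^sub>R y) \<le> (1 - t) * g x + t * g y"
      using convex_onD[OF assms(2), of t, OF _ _ mem[OF xy(1)] mem[OF xy(2)]] t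
      by (simp add: g[OF c] g[OF xy(1)] g[OF xy(2)])
  qed simp
  then have "g \<nu> \<le> dyadic_interp g N \<nu>"
    using assms(4,5) by (rule convex_on_le_dyadic_interp)
  moreover have "(\<Sum>j = 1..N. dyadic_A j \<nu> * dyadic_Delta j f \<nu> a b) =
      dyadic_interp g 0 \<nu> - dyadic_interp g N \<nu>"
    by (induction N) (simp_all add: dyadic_A_Delta_Suc g_def[abs_def])
  moreover have "dyadic_interp g 0 \<nu> = (1 - \<nu>) * g 0 + \<nu> * g 1"
  \<comment> \<open>At \<open>\<nu> = 1\<close> the floor jumps to 1, so the left node alone gives
    \<open>g 1\<close>.\<close>
  proof (cases "\<nu> = 1")
    case False
    then have "\<lfloor>\<nu>\<rfloor> = 0"
      using assms(4,5) by (simp add: floor_eq_iff)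
    then show ?thesis
      by (simp add: dyadic_interp_def frac_def)
  qed (simp add: dyadic_interp_def)
  ultimately show ?thesis
    using assms(4,5) by (simp add: g)
qed

end
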